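(* There is an absolute constant $C<\infty$ such that the following holds. Let $\mu$ be a positive measure on $\mathbb{R}^d$, and let $\mathcal{E}$ be a collection of measurable sets of finite $\mu$-measure. Let $A$ be the constant obtained as the result of running the greedy algorithm described in the context on $\mathcal{E}$. Then $$A\le\|\mathcal{E}\|_{\mathrm{Carleson}(\mu)}\le C\,A\log(e+A).$$
   Context: A collection is a finite unordered sequence of sets; repeated elements are allowed, and sums over a collection count multiplicity. The convention $\frac00=0$ is used. For a collection $\mathcal{F}$ put $$\mathrm{sh}(\mathcal{F})=\bigcup_{R\in\mathcal{F}}R,\qquad h_{\mathcal{F}}=\sum_{R\in\mathcal{F}}\mathbbm{1}_R,\qquad \Lambda_\mu(\mathcal{F})=\frac{1}{\mu(\mathrm{sh}(\mathcal{F}))}\int h_{\mathcal{F}}\,d\mu .$$ The Carleson constant is $\|\mathcal{E}\|_{\mathrm{Carleson}(\mu)}=\sup\{\Lambda_\mu(\mathcal{F}):\ \mathcal{F}\subseteq\mathcal{E}\}$. The greedy algorithm, with input a collection $\mathcal{E}$: set $A=1$. While the current collection (still denoted $\mathcal{E}$) is non-empty, do the following: (1) replace $A$ by $\max(A,\Lambda_\mu(\mathcal{E}))$, where $\mathcal{E}$ is the current collection; (2) for each $R$ in the current collection $\mathcal{E}$ define $$g_R=\frac{\mathbbm{1}_R}{h_{\mathcal{E}}}\,\mathbbm{1}_{\{x:\,h_{\mathcal{E}}(x)\le 2\Lambda_\mu(\mathcal{E})\}};$$ (3) run through the elements of the current collection until finding an $R$ with $\int g_R\,d\mu\ge\frac{\mu(R)}{2\Lambda_\mu(\mathcal{E})}$;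 remove this one $R$ from $\mathcal{E}$, record $f_R:=g_R$ and $\Lambda_R:=\Lambda_\mu(\mathcal{E})$ (computed before the removal), and return to step (1) with the reduced collection. (Such an $R$ always exists, so the algorithm terminates.) The output is the final constant $A$, together with the sequence $\{\Lambda_R\}$ and the functions $\{f_R\}$.
   Formalization: The lower bound A ≤ ‖E‖ is stated only when some set of the collection has positive measure; otherwise (e.g. E empty) every Λ is 0 while A = 1, so the lower bound fails. The upper bound is unrestricted. *)

theory Defs
  imports "HOL-Analysis.Analysis" "HOL-Library.Multiset"
begin

text \<open>
  A collection is a finite multiset of sets, so a subcollection is a submultiset and sums over a
  collection count multiplicity. Only measurable sets of finite measure are considered, so real-valued
  measures and Bochner integrals agree with the extended nonnegative ones. The convention
  \<open>0 / 0 = 0\<close> is the one of real division in HOL.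
\<close>

definition sh :: "'a set multiset \<Rightarrow> 'a set" where
  "sh F = \<Union>(set_mset F)"

definition height :: "'a set multiset \<Rightarrow> 'a \<Rightarrow> real" where
  "height F x = (\<Sum>R\<in>#F. indicator R x)"

definition Lam :: "'a measure \<Rightarrow> 'a set multiset \<Rightarrow> real" where
  "Lam M F = 1 / measure M (sh F) * (\<integral>x. height F x \<partial>M)"

text \<open>The supremum ranges over a finite nonempty set of reals; the empty subcollection
  contributes \<open>0\<close>.\<close>

definition carleson :: "'a measure \<Rightarrow> 'a set multiset \<Rightarrow> real" where
  "carleson M E = (SUP F\<in>{F. F \<subseteq># E}. Lam M F)"

definition greedy_fun :: "'a measure \<Rightarrow> 'a set multiset \<Rightarrow> 'a set \<Rightarrow> 'a \<Rightarrow> real" where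
  "greedy_fun M E R x =
     indicator R x / height E x * indicator {y. height E y \<le> 2 * Lam M E} x"

text \<open>
  A state consists of the current collection, the current value of \<open>A\<close> and the list of records
  \<open>(R, \<Lambda>\<^sub>R, f\<^sub>R)\<close> in order of removal. The order in which the elements are searched is
  unspecified, so every admissible \<open>R\<close> may be the one removed: the step is a relation.
\<close>

type_synonym 'a greedy_state = "'a set multiset \<times> real \<times> ('a set \<times> real \<times> ('a \<Rightarrow> real)) list"

inductive greedy_step :: "'a measure \<Rightarrow> 'a greedy_state \<Rightarrow> 'a greedy_state \<Rightarrow> bool"
  for M :: "'a measure" where
  "R \<in># E \<Longrightarrow> (\<integral>x. greedy_fun M E R x \<partial>M) \<ge> measure M R / (2 * Lam M E) \<Longrightarrow>
   greedy_step M (E, A, rs)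
     (E - {#R#}, max A (Lam M E), rs @ [(R, Lam M E, greedy_fun M E R)])"

definition greedy_output ::
  "'a measure \<Rightarrow> 'a set multiset \<Rightarrow> real \<Rightarrow> ('a set \<times> real \<times> ('a \<Rightarrow> real)) list \<Rightarrow> bool" where
  "greedy_output M E A rs \<longleftrightarrow> (greedy_step M)\<^sup>*\<^sup>* (E, 1, []) ({#}, A, rs)"

end

theory Submission
  imports Defs
begin

text \<open>
  Every removed \<open>R\<close> satisfies \<open>\<mu>(R) \<le> 2 A \<integral> f\<^sub>R\<close>, so for \<open>\<F> \<subseteq> \<E>\<close> the integral of the height of
  \<open>\<F>\<close> is at most \<open>2 A\<close> times that of the sum of the \<open>f\<^sub>R\<close>, \<open>R \<in> \<F>\<close>. At a point \<open>x\<close>, the removal of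
  a set containing \<open>x\<close> lowers the current height \<open>h(x)\<close> by one, and \<open>f\<^sub>R(x)\<close> is \<open>1 / h(x)\<close> if
  \<open>h(x) \<le> 2 A\<close> and \<open>0\<close> otherwise. The sum of the \<open>f\<^sub>R(x)\<close> is thus at most the harmonic number of
  \<open>2 A\<close>, which is where the logarithm comes from.
\<close>

section \<open>Shadows, heights and integrability\<close>

lemma sh_add [simp]: "sh (add_mset R E) = R \<union> sh E"
  by (simp add: sh_def)

lemma height_add [simp]: "height (add_mset R E) x = indicator R x + height E x"
  by (simp add: height_def)

lemma height_empty [simp]: "height {#} = (\<lambda>x. 0)"
  by (simp add: height_def fun_eq_iff)

definition finite_collection :: "'a measure \<Rightarrow> 'a set multiset \<Rightarrow> bool" where
  "finite_collection M E \<longleftrightarrow> (\<forall>R\<in>#E. R \<in> sets M \<and> emeasure M R < \<infinity>)"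

lemma finite_collection_subset:
  "finite_collection M E \<Longrightarrow> F \<subseteq># E \<Longrightarrow> finite_collection M F"
  unfolding finite_collection_def by (meson mset_subset_eqD)

lemma finite_collection_add [simp]:
  "finite_collection M (add_mset R E) \<longleftrightarrow>
     R \<in> sets M \<and> emeasure M R < \<infinity> \<and> finite_collection M E"
  by (auto simp: finite_collection_def)

lemma sh_fmeasurable:
  assumes "finite_collection M E"
  shows "sh E \<in> fmeasurable M"
  using assms
proof (induction E)
  case (add R E)
  then have "R \<in> fmeasurable M"
    by (simp add: fmeasurable_def)
  with add show ?case
    by (simp add: fmeasurable.Un)
qed (simp add: sh_def)

lemma integrable_height:
  "finite_collection M E \<Longrightarrow> integrable M (height E)"
proof (induction E)
  case (add R E)
  have "integrable M (\<lambda>x. indicator R x + height E x)"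
    using add by (intro Bochner_Integration.integrable_add) auto
  then show ?case by simp
qed simp

lemma height_eq_card: "height E x = real (size {#R \<in># E. x \<in> R#})"
  by (induction E) (auto simp: indicator_def)

lemma height_nonneg: "height E x \<ge> 0"
  by (simp add: height_eq_card)

lemma measure_le_integral_height:
  assumes "finite_collection M E" "R \<in># E"
  shows "measure M R \<le> (\<integral>x. height E x \<partial>M)"
proof -
  have R: "R \<in> sets M" "emeasure M R < \<infinity>"
    using assms by (auto simp: finite_collection_def)
  obtain E' where "E = add_mset R E'"
    using assms(2) by (metis insert_DiffM)
  then have "indicator R x \<le> height E x" for x
    using height_nonneg[of E' x] by simp
  then have "(\<integral>x. indicator R x \<partial>M) \<le> (\<integral>x. height E x \<partial>M)"
    using R by (intro integral_mono integrable_height assms) auto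
  then show ?thesis
    using R by simp
qed

lemma Lam_nonneg: "Lam M E \<ge> 0"
  unfolding Lam_def by (simp add: height_nonneg integral_nonneg_AE)

section \<open>Estimates for one removal and the harmonic potential\<close>

lemma greedy_fun_nonneg: "greedy_fun M E R x \<ge> 0"
  unfolding greedy_fun_def by (simp add: height_nonneg)

lemma integrable_greedy_fun:
  assumes "finite_collection M E" "R \<in># E"
  shows "integrable M (greedy_fun M E R)"
proof (rule Bochner_Integration.integrable_bound)
  have R: "R \<in> sets M" "emeasure M R < \<infinity>"
    using assms by (auto simp: finite_collection_def)
  show "integrable M (\<lambda>x. indicator R x :: real)"
    using R by auto
  have [measurable]: "R \<in> sets M" "height E \<in> borel_measurable M"
    using R integrable_height[OF assms(1)] by auto
  have "(\<lambda>x. indicator R x / height E x * (if height E x \<le> 2 * Lam M E then 1 else 0))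
      \<in> borel_measurable M"
    by measurable
  moreover have "greedy_fun M E R =
      (\<lambda>x. indicator R x / height E x * (if height E x \<le> 2 * Lam M E then 1 else 0))"
    by (auto simp: greedy_fun_def indicator_def)
  ultimately show "greedy_fun M E R \<in> borel_measurable M"
    by simp
  \<comment> \<open>On \<open>R\<close> the height is at least 1, since \<open>R\<close> itself is
    counted; hence the quotient is at most \<open>indicator R\<close>.\<close>
  obtain E' where "E = add_mset R E'"
    using assms(2) by (metis insert_DiffM)
  then have "norm (greedy_fun M E R x) \<le> norm (indicator R x :: real)" for x
    using height_nonneg[of E' x] by (auto simp: greedy_fun_def indicator_def)
  then show "AE x in M. norm (greedy_fun M E R x) \<le> norm (indicator R x :: real)"
    by simp
qed

text \<open>Only \<open>Lam M E = 0\<close> needs care: division by 0 then yields 0 and the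
  selection rule says nothing. In that case \<open>R\<close> is null, being contained in a null
  shadow or having measure at most the vanishing integral of the height.\<close>

lemma measure_le_integral_greedy_fun:
  assumes "finite_collection M E" "R \<in># E"
    and "(\<integral>x. greedy_fun M E R x \<partial>M) \<ge> measure M R / (2 * Lam M E)"
  shows "measure M R \<le> 2 * Lam M E * (\<integral>x. greedy_fun M E R x \<partial>M)"
proof (cases "Lam M E = 0")
  case True
  have "measure M R \<le> 0"
  proof (cases "measure M (sh E) = 0")
    case True
    have "measure M R \<le> measure M (sh E)"
      using assms sh_fmeasurable[OF assms(1)]
      by (intro measure_mono_fmeasurable) (auto simp: finite_collection_def sh_def)
    with True show ?thesis by simp
  next
    case False
    with \<open>Lam M E = 0\<close> have "(\<integral>x. height E x \<partial>M) = 0"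
      by (simp add: Lam_def)
    with measure_le_integral_height[OF assms(1,2)] show ?thesis by simp
  qed
  with True show ?thesis by simp
next
  case False
  then have "Lam M E > 0"
    using Lam_nonneg[of M E] by simp
  with assms(3) show ?thesis
    by (simp add: field_simps)
qed

text \<open>\<open>harm\<close> at the capped height is the potential that pays for the value \<open>f\<^sub>R(x)\<close> at each removal.\<close>

definition harm_height :: "real \<Rightarrow> 'a set multiset \<Rightarrow> 'a \<Rightarrow> real" where
  "harm_height B E x = harm (min (size {#R \<in># E. x \<in> R#}) (nat \<lfloor>B\<rfloor>))"

text \<open>Where the removed function is nonzero, the number of sets containing \<open>x\<close> is
  some \<open>Suc n \<le> B\<close>, so the cap is inactive and the potential drops by exactly
  \<open>1 / Suc n\<close>. Elsewhere monotonicity of \<open>harm\<close> is enough.\<close>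

lemma harm_height_add:
  assumes "R \<in># E" "2 * Lam M E \<le> B"
  shows "harm_height B (E - {#R#}) x + greedy_fun M E R x \<le> harm_height B E x"
proof -
  obtain E' where E: "E = add_mset R E'"
    using assms(1) by (metis insert_DiffM)
  define n where "n = size {#S \<in># E'. x \<in> S#}"
  show ?thesis
  proof (cases "x \<in> R \<and> height E x \<le> 2 * Lam M E")
    case True
    then have "real (Suc n) \<le> B"
      using assms(2) by (auto simp: E height_eq_card n_def)
    then have "Suc n \<le> nat \<lfloor>B\<rfloor>"
      by linarith
    moreover from True have "greedy_fun M E R x = 1 / real (Suc n)"
      by (simp add: greedy_fun_def) (simp add: E n_def height_eq_card)
    ultimately show ?thesis
      using True by (simp add: E harm_height_def n_def[symmetric] harm_Suc inverse_eq_divide)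
  next
    case False
    then have "greedy_fun M E R x = 0"
      by (auto simp: greedy_fun_def)
    moreover have "harm_height B E' x \<le> harm_height B E x"
      unfolding harm_height_def E by (intro harm_mono) auto
    ultimately show ?thesis
      by (simp add: E)
  qed
qed

lemma harm_height_le: "B \<ge> 1 \<Longrightarrow> harm_height B E x \<le> ln B + 1"
proof -
  assume B: "B \<ge> 1"
  have "harm_height B E x \<le> harm (nat \<lfloor>B\<rfloor>)"
    unfolding harm_height_def by (intro harm_mono) auto
  \<comment> \<open>The sequence \<open>harm n - ln n\<close> decreases and equals 1 at
    \<open>n = 1\<close>.\<close>
  also have "\<dots> \<le> ln (real (nat \<lfloor>B\<rfloor>)) + 1"
    using euler_mascheroni_sequence_decreasing[of 1 "nat \<lfloor>B\<rfloor>"] B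
    by (simp add: harm_expand le_nat_floor)
  also have "\<dots> \<le> ln B + 1"
    using B by (simp add: le_nat_floor)
  finally show ?thesis .
qed

section \<open>Runs of the algorithm\<close>

text \<open>Every current collection is a subcollection of the initial one. With the Carleson
  constant as \<open>B\<close> this becomes the lower bound of the theorem.\<close>

lemma greedy_steps_max_le:
  assumes "(greedy_step M)\<^sup>*\<^sup>* (E, A\<^sub>0, rs\<^sub>0) (E', A, rs)"
    and "A\<^sub>0 \<le> B" "\<And>F. F \<subseteq># E \<Longrightarrow> Lam M F \<le> B"
  shows "A \<le> B"
  using assms
proof (induction "(E, A\<^sub>0, rs\<^sub>0)" arbitrary: E A\<^sub>0 rs\<^sub>0 rule: converse_rtranclp_induct)
  case (step z)
  from step(1) show ?case
  proof cases
    case (1 R)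
    show ?thesis
    proof (rule step(3)[OF 1(1)])
      show "max A\<^sub>0 (Lam M E) \<le> B"
        using step.prems by simp
      show "Lam M F \<le> B" if "F \<subseteq># E - {#R#}" for F
        using that step.prems by (meson diff_subset_eq_self subset_mset.order_trans)
    qed
  qed
qed simp

lemma greedy_steps_mono:
  assumes "(greedy_step M)\<^sup>*\<^sup>* (E, A\<^sub>0, rs\<^sub>0) (E', A, rs)"
  shows "A\<^sub>0 \<le> A"
  using assms
proof (induction "(E, A\<^sub>0, rs\<^sub>0)" arbitrary: E A\<^sub>0 rs\<^sub>0 rule: converse_rtranclp_induct)
  case (step z)
  from step(1) show ?case
    by cases (use step(3) in fastforce)
qed simp

text \<open>The witness \<open>g\<close> is the sum of the removed functions charged to
  \<open>F\<close>; the factor \<open>indicator (sh F)\<close> records that each of them lives on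
  its set. The induction is over the remaining removals from an arbitrary state, with the final
  \<open>A\<close> fixed.\<close>

lemma greedy_steps_domination:
  assumes "(greedy_step M)\<^sup>*\<^sup>* (E, A\<^sub>0, rs\<^sub>0) ({#}, A, rs)"
    and "finite_collection M E" "F \<subseteq># E"
  shows "\<exists>g. integrable M g \<and> (\<forall>x. g x \<le> indicator (sh F) x * harm_height (2 * A) E x)
           \<and> (\<integral>x. height F x \<partial>M) \<le> 2 * A * (\<integral>x. g x \<partial>M)"
  using assms
proof (induction "(E, A\<^sub>0, rs\<^sub>0)" arbitrary: E A\<^sub>0 rs\<^sub>0 F rule: converse_rtranclp_induct)
  case base
  then show ?case
    by (intro exI[of _ "\<lambda>_. 0"]) (simp add: sh_def)
next
  case (step z)
  from step(1) show ?case
  proof cases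
    case (1 R)
    define f where "f = greedy_fun M E R"
    \<comment> \<open>Since the running constant never decreases, the current \<open>Lam M E\<close>
      is below its final value; this serves both the cap \<open>2 * A\<close> and the factor
      \<open>2 * A\<close>.\<close>
    have "max A\<^sub>0 (Lam M E) \<le> A"
      using greedy_steps_mono step(2) 1(1) by fast
    then have LA: "Lam M E \<le> A"
      by simp
    have fin': "finite_collection M (E - {#R#})"
      using step.prems(1) by (rule finite_collection_subset) simp
    have f: "integrable M f"
      unfolding f_def by (rule integrable_greedy_fun[OF step.prems(1) 1(2)])
    have pot: "harm_height (2 * A) (E - {#R#}) x + f x \<le> harm_height (2 * A) E x" for x
      unfolding f_def using LA by (intro harm_height_add 1(2)) simp
    have f0: "f x \<ge> 0" for x
      unfolding f_def by (rule greedy_fun_nonneg)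
    show ?thesis
    \<comment> \<open>If \<open>F\<close> still fits after the removal, which can happen with
      \<open>R \<in># F\<close> when \<open>E\<close> has spare copies of \<open>R\<close>, nothing
      is charged and \<open>f\<close> is dropped. Otherwise the removed copy is charged to
      \<open>F\<close>.\<close>
    proof (cases "F \<subseteq># E - {#R#}")
      case True
      from step(3)[OF 1(1) fin' True] obtain g where g: "integrable M g"
        "\<And>x. g x \<le> indicator (sh F) x * harm_height (2 * A) (E - {#R#}) x"
        "(\<integral>x. height F x \<partial>M) \<le> 2 * A * (\<integral>x. g x \<partial>M)"
        by blast
      have "g x \<le> indicator (sh F) x * harm_height (2 * A) E x" for x
        using g(2)[of x] pot[of x] f0[of x] by (cases "x \<in> sh F") auto
      with g show ?thesis
        by blast
    next
      case False
      have "F \<subseteq># E - {#R#}" if "R \<notin># F"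
        using that step.prems(2) by (auto simp: subseteq_mset_def not_in_iff)
      with False have "R \<in># F"
        by blast
      then obtain F' where F: "F = add_mset R F'"
        by (metis insert_DiffM)
      have F': "F' \<subseteq># E - {#R#}"
        using step.prems(2) 1(2) by (simp add: F insert_subset_eq_iff)
      from step(3)[OF 1(1) fin' F'] obtain g where g: "integrable M g"
        "\<And>x. g x \<le> indicator (sh F') x * harm_height (2 * A) (E - {#R#}) x"
        "(\<integral>x. height F' x \<partial>M) \<le> 2 * A * (\<integral>x. g x \<partial>M)"
        by blast
      have R: "R \<in> sets M" "emeasure M R < \<infinity>"
        using step.prems(1) 1(2) by (auto simp: finite_collection_def)
      have finF: "finite_collection M F'"
        using fin' F' by (rule finite_collection_subset)
      have "g x + f x \<le> indicator (sh F) x * harm_height (2 * A) E x" for x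
      proof (cases "x \<in> sh F")
        case True
        \<comment> \<open>On \<open>R\<close> outside \<open>sh F'\<close> the induction hypothesis
          only gives \<open>g x \<le> 0\<close>; a nonnegative potential lets both cases share one
          bound.\<close>
        have "harm_height (2 * A) (E - {#R#}) x \<ge> 0"
          by (simp add: harm_height_def harm_nonneg)
        with g(2)[of x] have "g x \<le> harm_height (2 * A) (E - {#R#}) x"
          by (cases "x \<in> sh F'") auto
        with True pot[of x] show ?thesis by simp
      next
        case False
        with g(2)[of x] show ?thesis
          by (simp add: F f_def greedy_fun_def)
      qed
      moreover have "(\<integral>x. height F x \<partial>M) = measure M R + (\<integral>x. height F' x \<partial>M)"
        using R integrable_height[OF finF] by (simp add: F)
      moreover have "measure M R \<le> 2 * Lam M E * (\<integral>x. f x \<partial>M)"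
        using measure_le_integral_greedy_fun[OF step.prems(1) 1(2,3)] by (simp add: f_def)
      moreover have "\<dots> \<le> 2 * A * (\<integral>x. f x \<partial>M)"
        using LA f0 by (intro mult_right_mono) (auto intro: integral_nonneg_AE)
      moreover have "(\<integral>x. g x + f x \<partial>M) = (\<integral>x. g x \<partial>M) + (\<integral>x. f x \<partial>M)"
        using g(1) f by simp
      ultimately show ?thesis
        using g f by (intro exI[of _ "\<lambda>x. g x + f x"]) (auto simp: algebra_simps)
    qed
  qed
qed

section \<open>The two bounds for the Carleson constant\<close>

lemma greedy_output_ge_1: "greedy_output M E A rs \<Longrightarrow> A \<ge> 1"
  unfolding greedy_output_def by (rule greedy_steps_mono)

lemma Lam_le_greedy_output:
  assumes out: "greedy_output M E A rs" and fin: "finite_collection M E" and F: "F \<subseteq># E"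
  shows "Lam M F \<le> 6 * A * ln (exp 1 + A)"
proof -
  have A: "A \<ge> 1"
    using out by (rule greedy_output_ge_1)
  obtain g where g: "integrable M g"
    "\<And>x. g x \<le> indicator (sh F) x * harm_height (2 * A) E x"
    "(\<integral>x. height F x \<partial>M) \<le> 2 * A * (\<integral>x. g x \<partial>M)"
    using greedy_steps_domination[OF out[unfolded greedy_output_def] fin F] by blast
  have finF: "sh F \<in> fmeasurable M"
    by (intro sh_fmeasurable finite_collection_subset[OF fin F])
  have gle: "g x \<le> indicator (sh F) x * (ln (2 * A) + 1)" for x
    using g(2)[of x] harm_height_le[of "2 * A" E x] A by (cases "x \<in> sh F") auto
  have "(\<integral>x. g x \<partial>M) \<le> (\<integral>x. indicator (sh F) x * (ln (2 * A) + 1) \<partial>M)"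
    using finF by (intro integral_mono g gle) (auto simp: fmeasurable_def)
  also have "\<dots> = measure M (sh F) * (ln (2 * A) + 1)"
    using finF by (simp add: fmeasurable_def)
  finally have int: "(\<integral>x. height F x \<partial>M) \<le> 2 * A * (measure M (sh F) * (ln (2 * A) + 1))"
    using g(3) A by (smt (verit) mult_left_mono)
  have ln1: "1 \<le> ln (exp 1 + A)"
    using A ln_mono[of "exp 1" "exp 1 + A"] by (simp add: add_pos_pos)
  have "ln (2 * A) = ln 2 + ln A"
    using A by (simp add: ln_mult)
  moreover have "ln 2 \<le> (1::real)"
    using ln_le_minus_one[of "2::real"] by simp
  moreover have "ln A \<le> ln (exp 1 + A)"
    using A ln_mono[of A "exp 1 + A"] by simp
  \<comment> \<open>Each of \<open>ln 2\<close>, \<open>ln A\<close> and 1 is at most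
    \<open>ln (exp 1 + A)\<close>; together with the factor \<open>2 * A\<close> this gives the
    constant 6.\<close>
  ultimately have "ln (2 * A) + 1 \<le> 3 * ln (exp 1 + A)"
    using ln1 by linarith
  then have log: "2 * A * (ln (2 * A) + 1) \<le> 6 * A * ln (exp 1 + A)"
    using A mult_left_mono[of "ln (2 * A) + 1" "3 * ln (exp 1 + A)" "2 * A"] by simp
  show ?thesis
  proof (cases "measure M (sh F) = 0")
    \<comment> \<open>Over a null shadow, \<open>Lam M F\<close> is 0 by the convention for division
      by 0.\<close>
    case True
    with A ln1 show ?thesis
      by (simp add: Lam_def)
  next
    case False
    then have "measure M (sh F) > 0"
      by (simp add: zero_less_measure_iff)
    with int have "Lam M F \<le> 2 * A * (ln (2 * A) + 1)"
      by (simp add: Lam_def field_simps)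
    with log show ?thesis by simp
  qed
qed

lemma Lam_singleton:
  assumes "R \<in> sets M" "0 < emeasure M R" "emeasure M R < \<infinity>"
  shows "Lam M {#R#} = 1"
proof -
  have "measure M R \<noteq> 0"
    using assms by (auto simp: measure_def enn2real_eq_0_iff)
  with assms show ?thesis
    by (simp add: Lam_def sh_def height_def)
qed

theorem theorem2p2:
  "\<exists>C::real. \<forall>(d::nat) (\<mu>::(nat \<Rightarrow> real) measure) (E::(nat \<Rightarrow> real) set multiset) A rs.
     space \<mu> = ({..<d} \<rightarrow>\<^sub>E UNIV) \<longrightarrow>
     (\<forall>R\<in>#E. R \<in> sets \<mu> \<and> emeasure \<mu> R < \<infinity>) \<longrightarrow>
     greedy_output \<mu> E A rs \<longrightarrow>
     ((\<exists>R\<in>#E. emeasure \<mu> R > 0) \<longrightarrow> A \<le> carleson \<mu> E) \<and>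
     carleson \<mu> E \<le> C * A * ln (exp 1 + A)"
proof (intro exI[of _ 6] allI impI conjI)
  fix d :: nat and \<mu> :: "(nat \<Rightarrow> real) measure" and E :: "(nat \<Rightarrow> real) set multiset" and A rs
  assume "\<forall>R\<in>#E. R \<in> sets \<mu> \<and> emeasure \<mu> R < \<infinity>" and out: "greedy_output \<mu> E A rs"
  then have fin: "finite_collection \<mu> E"
    by (simp add: finite_collection_def)
  note upper = Lam_le_greedy_output[OF out fin]
  show "carleson \<mu> E \<le> 6 * A * ln (exp 1 + A)"
    unfolding carleson_def by (rule cSUP_least) (use upper in auto)
  \<comment> \<open>A real supremum dominates its members only over a bounded set; the upper
    estimate supplies the boundedness.\<close>
  have lower: "Lam \<mu> F \<le> carleson \<mu> E" if "F \<subseteq># E" for F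
    unfolding carleson_def by (rule cSUP_upper) (use upper that in \<open>auto intro!: bdd_aboveI\<close>)
  \<comment> \<open>The algorithm starts from \<open>A = 1\<close>, so the Carleson constant must be
    at least 1. A single set of positive measure ensures this, whereas null sets alone would give
    0.\<close>
  assume "\<exists>R\<in>#E. emeasure \<mu> R > 0"
  then obtain R where R: "R \<in># E" "emeasure \<mu> R > 0"
    by blast
  then have "Lam \<mu> {#R#} = 1"
    using fin by (intro Lam_singleton) (auto simp: finite_collection_def)
  with lower[of "{#R#}"] R have "1 \<le> carleson \<mu> E"
    by simp
  with lower show "A \<le> carleson \<mu> E"
    using greedy_steps_max_le[OF out[unfolded greedy_output_def]] by blast
qed

end
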